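(* Let $v\ge0$, let $\varsigma\in\mathcal{S}_p(v,0)$ be a prime substitution, and let $d\ge0$. Then: (a) the map $\mu\mapsto\mu\circ\varsigma$ is a bijection of the set of level-$d$ minterms of $\mathbf{K}[v,d]$ onto itself (in particular $\mu\circ\varsigma$ is again a minterm); (b) the map $\varphi\mapsto\varphi\circ\varsigma$ is a lattice automorphism of $\mathbf{K}[v,d]$.
   Context: Formulas are unimodal propositional formulas in variables $p_0,\dots,p_{v-1}$; $\mathbf{K}$ is the least normal modal logic. $\mathbf{K}[v,d]$ is the Lindenbaum–Tarski algebra of formulas in $p_0,\dots,p_{v-1}$ of modal degree $\le d$ modulo $\mathbf{K}$-equivalence; it is a finite Boolean algebra whose atoms (minterms) are: level 0: the $2^v$ conjunctions $\bigwedge_i\pm p_i$; level $d+1$: all $m\wedge\bigwedge_\mu\pm\Diamond\mu$ with $m$ a level-0 minterm and $\mu$ ranging over all level-$d$ minterms (all sign choices). A level-0 substitution is a tuple $\sigma=(\sigma_0,\dots,\sigma_{v-1})$ of classical propositional formulas (up to equivalence) in $p_0,\dots,p_{v-1}$, acting by $\varphi\circ\sigma=\varphi(\sigma_0,\dots,\sigma_{v-1})$ (well defined on $\mathbf{K}$-classes); composition $(\sigma\sigma')_i=\sigma_i(\sigma'_0,\dots,\sigma'_{v-1})$ makes these a monoid with identity $(p_0,\dots,p_{v-1})$, and the prime substitutions are its invertible elements, forming the group $\mathcal{S}_p(v,0)$. *)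

theory Defs
  imports "HOL-Algebra.Group" "HOL-Algebra.Lattice"
begin

section \<open>Modal formulas and the logic K\<close>

datatype fm = Bot | Var nat | Imp fm fm | Box fm

abbreviation Neg :: "fm \<Rightarrow> fm" where "Neg \<phi> \<equiv> Imp \<phi> Bot"
abbreviation Top :: fm where "Top \<equiv> Neg Bot"
abbreviation Or :: "fm \<Rightarrow> fm \<Rightarrow> fm" where "Or \<phi> \<psi> \<equiv> Imp (Neg \<phi>) \<psi>"
abbreviation And :: "fm \<Rightarrow> fm \<Rightarrow> fm" where "And \<phi> \<psi> \<equiv> Neg (Imp \<phi> (Neg \<psi>))"
abbreviation Iff :: "fm \<Rightarrow> fm \<Rightarrow> fm" where "Iff \<phi> \<psi> \<equiv> And (Imp \<phi> \<psi>) (Imp \<psi> \<phi>)"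
abbreviation Dia :: "fm \<Rightarrow> fm" where "Dia \<phi> \<equiv> Neg (Box (Neg \<phi>))"

primrec vars :: "fm \<Rightarrow> nat set" where
  "vars Bot = {}"
| "vars (Var i) = {i}"
| "vars (Imp \<phi> \<psi>) = vars \<phi> \<union> vars \<psi>"
| "vars (Box \<phi>) = vars \<phi>"

primrec deg :: "fm \<Rightarrow> nat" where
  "deg Bot = 0"
| "deg (Var i) = 0"
| "deg (Imp \<phi> \<psi>) = max (deg \<phi>) (deg \<psi>)"
| "deg (Box \<phi>) = Suc (deg \<phi>)"

primrec subst :: "(nat \<Rightarrow> fm) \<Rightarrow> fm \<Rightarrow> fm" where
  "subst \<sigma> Bot = Bot"
| "subst \<sigma> (Var i) = \<sigma> i"
| "subst \<sigma> (Imp \<phi> \<psi>) = Imp (subst \<sigma> \<phi>) (subst \<sigma> \<psi>)"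
| "subst \<sigma> (Box \<phi>) = Box (subst \<sigma> \<phi>)"

text \<open>Classical truth: variables and boxed formulas are evaluated as atoms by \<open>V\<close>.\<close>

primrec tval :: "(fm \<Rightarrow> bool) \<Rightarrow> fm \<Rightarrow> bool" where
  "tval V Bot \<longleftrightarrow> False"
| "tval V (Var i) \<longleftrightarrow> V (Var i)"
| "tval V (Imp \<phi> \<psi>) \<longleftrightarrow> (tval V \<phi> \<longrightarrow> tval V \<psi>)"
| "tval V (Box \<phi>) \<longleftrightarrow> V (Box \<phi>)"

definition taut :: "fm \<Rightarrow> bool" where
  "taut \<phi> \<longleftrightarrow> (\<forall>V. tval V \<phi>)"

definition normal_logic :: "fm set \<Rightarrow> bool" where
  "normal_logic L \<longleftrightarrow>
     (\<forall>\<phi>. taut \<phi> \<longrightarrow> \<phi> \<in> L) \<and>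
     (\<forall>\<phi> \<psi>. Imp (Box (Imp \<phi> \<psi>)) (Imp (Box \<phi>) (Box \<psi>)) \<in> L) \<and>
     (\<forall>\<phi> \<psi>. \<phi> \<in> L \<longrightarrow> Imp \<phi> \<psi> \<in> L \<longrightarrow> \<psi> \<in> L) \<and>
     (\<forall>\<phi>. \<phi> \<in> L \<longrightarrow> Box \<phi> \<in> L) \<and>
     (\<forall>\<phi> \<sigma>. \<phi> \<in> L \<longrightarrow> subst \<sigma> \<phi> \<in> L)"

definition logicK :: "fm set" where
  "logicK = \<Inter>{L. normal_logic L}"


section \<open>The Lindenbaum--Tarski algebras\<close>

definition forms :: "nat \<Rightarrow> nat \<Rightarrow> fm set" where
  "forms v d = {\<phi>. vars \<phi> \<subseteq> {..<v} \<and> deg \<phi> \<le> d}"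

definition K_rel :: "nat \<Rightarrow> nat \<Rightarrow> (fm \<times> fm) set" where
  "K_rel v d = {(\<phi>, \<psi>). \<phi> \<in> forms v d \<and> \<psi> \<in> forms v d \<and> Iff \<phi> \<psi> \<in> logicK}"

definition K_cls :: "nat \<Rightarrow> nat \<Rightarrow> fm \<Rightarrow> fm set" where
  "K_cls v d \<phi> = K_rel v d `` {\<phi>}"

text \<open>The algebra is given by its lattice order; that joins and meets in this order are the
  classes of disjunctions and conjunctions is \<open>K_alg_join\<close> and \<open>K_alg_meet\<close> below.\<close>

definition K_alg :: "nat \<Rightarrow> nat \<Rightarrow> fm set gorder" where
  "K_alg v d = \<lparr>carrier = forms v d // K_rel v d, eq = (=),
     le = (\<lambda>X Y. \<exists>\<phi>\<in>X. \<exists>\<psi>\<in>Y. Imp \<phi> \<psi> \<in> logicK)\<rparr>"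

definition lattice_automorphism :: "('a, 'b) gorder_scheme \<Rightarrow> ('a \<Rightarrow> 'a) \<Rightarrow> bool" where
  "lattice_automorphism L f \<longleftrightarrow>
     bij_betw f (carrier L) (carrier L) \<and> join_pres L L f \<and> meet_pres L L f"


section \<open>Minterms\<close>

definition lit :: "bool \<Rightarrow> fm \<Rightarrow> fm" where
  "lit b \<phi> = (if b then \<phi> else Neg \<phi>)"

definition Conj :: "fm list \<Rightarrow> fm" where
  "Conj \<phi>s = foldr And \<phi>s Top"

definition signed_conjs :: "fm list \<Rightarrow> fm list" where
  "signed_conjs \<phi>s = map (\<lambda>bs. Conj (map2 lit bs \<phi>s)) (List.n_lists (length \<phi>s) [True, False])"

text \<open>Lists rather than sets, so that the conjunction over all minterms of the previous level
  is a formula.\<close>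

primrec minterm_list :: "nat \<Rightarrow> nat \<Rightarrow> fm list" where
  "minterm_list v 0 = signed_conjs (map Var [0..<v])"
| "minterm_list v (Suc d) =
     [And m c. m \<leftarrow> signed_conjs (map Var [0..<v]), c \<leftarrow> signed_conjs (map Dia (minterm_list v d))]"

definition minterms :: "nat \<Rightarrow> nat \<Rightarrow> fm set set" where
  "minterms v d = K_cls v d ` set (minterm_list v d)"


section \<open>Level-0 substitutions\<close>

definition C_rel :: "nat \<Rightarrow> (fm \<times> fm) set" where
  "C_rel v = {(\<phi>, \<psi>). \<phi> \<in> forms v 0 \<and> \<psi> \<in> forms v 0 \<and> taut (Iff \<phi> \<psi>)}"

definition rep :: "fm set \<Rightarrow> fm" where
  "rep X = (SOME \<phi>. \<phi> \<in> X)"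

definition subst_monoid :: "nat \<Rightarrow> (nat \<Rightarrow> fm set) monoid" where
  "subst_monoid v =
    \<lparr>carrier = {..<v} \<rightarrow>\<^sub>E (forms v 0 // C_rel v),
     mult = (\<lambda>S T. \<lambda>i\<in>{..<v}. C_rel v `` {subst (\<lambda>j. rep (T j)) (rep (S i))}),
     one = (\<lambda>i\<in>{..<v}. C_rel v `` {Var i})\<rparr>"

definition prime_substs :: "nat \<Rightarrow> (nat \<Rightarrow> fm set) monoid" where
  "prime_substs v = units_of (subst_monoid v)"

text \<open>The action \<open>\<phi> \<mapsto> \<phi> \<circ> \<sigma>\<close> on classes; independence of the representatives is
  \<open>K_act_cls\<close> below.\<close>

definition K_act :: "nat \<Rightarrow> nat \<Rightarrow> (nat \<Rightarrow> fm set) \<Rightarrow> fm set \<Rightarrow> fm set" where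
  "K_act v d S X = K_cls v d (subst (\<lambda>i. rep (S i)) (rep X))"


section \<open>Well-definedness\<close>

lemma normal_logicK: "normal_logic logicK"
  unfolding logicK_def normal_logic_def by blast

lemma K_taut: "taut \<phi> \<Longrightarrow> \<phi> \<in> logicK"
  and K_dist: "Imp (Box (Imp \<phi> \<psi>)) (Imp (Box \<phi>) (Box \<psi>)) \<in> logicK"
  and K_mp: "\<phi> \<in> logicK \<Longrightarrow> Imp \<phi> \<psi> \<in> logicK \<Longrightarrow> \<psi> \<in> logicK"
  and K_nec: "\<phi> \<in> logicK \<Longrightarrow> Box \<phi> \<in> logicK"
  and K_subst: "\<phi> \<in> logicK \<Longrightarrow> subst \<sigma> \<phi> \<in> logicK"
  using normal_logicK unfolding normal_logic_def by blast+

lemma K_taut1: "\<phi> \<in> logicK \<Longrightarrow> taut (Imp \<phi> \<chi>) \<Longrightarrow> \<chi> \<in> logicK"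
  using K_taut K_mp by blast

lemma K_taut2: "\<phi> \<in> logicK \<Longrightarrow> \<psi> \<in> logicK \<Longrightarrow> taut (Imp \<phi> (Imp \<psi> \<chi>)) \<Longrightarrow> \<chi> \<in> logicK"
  using K_taut K_mp by blast

lemma K_Iff: "Iff \<phi> \<psi> \<in> logicK \<longleftrightarrow> Imp \<phi> \<psi> \<in> logicK \<and> Imp \<psi> \<phi> \<in> logicK"
proof
  assume *: "Iff \<phi> \<psi> \<in> logicK"
  show "Imp \<phi> \<psi> \<in> logicK \<and> Imp \<psi> \<phi> \<in> logicK"
    by (intro conjI; rule K_taut1[OF *]) (auto simp: taut_def)
next
  assume *: "Imp \<phi> \<psi> \<in> logicK \<and> Imp \<psi> \<phi> \<in> logicK"
  show "Iff \<phi> \<psi> \<in> logicK"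
    by (rule K_taut2[OF conjunct1[OF *] conjunct2[OF *]]) (simp add: taut_def)
qed

lemma K_Imp_refl: "Imp \<phi> \<phi> \<in> logicK"
  by (rule K_taut) (simp add: taut_def)

lemma K_Imp_trans: "Imp \<phi> \<psi> \<in> logicK \<Longrightarrow> Imp \<psi> \<chi> \<in> logicK \<Longrightarrow> Imp \<phi> \<chi> \<in> logicK"
  by (erule K_taut2, assumption) (simp add: taut_def)

lemma K_Box_mono: "Imp \<phi> \<psi> \<in> logicK \<Longrightarrow> Imp (Box \<phi>) (Box \<psi>) \<in> logicK"
  using K_nec K_dist K_mp by blast

lemma K_subst_cong:
  "(\<And>i. i \<in> vars \<phi> \<Longrightarrow> Iff (\<sigma> i) (\<tau> i) \<in> logicK) \<Longrightarrow> Iff (subst \<sigma> \<phi>) (subst \<tau> \<phi>) \<in> logicK"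
proof (induction \<phi>)
  case (Imp \<phi> \<psi>)
  then have "Iff (subst \<sigma> \<phi>) (subst \<tau> \<phi>) \<in> logicK" "Iff (subst \<sigma> \<psi>) (subst \<tau> \<psi>) \<in> logicK"
    by simp_all
  then show ?case
    by (rule K_taut2) (auto simp: taut_def)
next
  case (Box \<phi>)
  then show ?case by (simp add: K_Iff K_Box_mono)
qed (auto simp: K_Iff K_Imp_refl)

lemma taut_Iff: "taut (Iff \<phi> \<psi>) \<longleftrightarrow> (\<forall>V. tval V \<phi> = tval V \<psi>)"
  unfolding taut_def by (rule iff_allI) auto

lemma tval_subst:
  "tval V (subst \<sigma> \<phi>) =
   tval (\<lambda>\<chi>. case \<chi> of Var i \<Rightarrow> tval V (\<sigma> i) | Box \<psi> \<Rightarrow> V (Box (subst \<sigma> \<psi>)) | _ \<Rightarrow> False) \<phi>"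
  by (induction \<phi>) auto

lemma taut_subst: "taut \<phi> \<Longrightarrow> taut (subst \<sigma> \<phi>)"
  by (simp add: taut_def tval_subst)

lemma taut_subst_cong:
  assumes "deg \<phi> = 0" "\<And>i. i \<in> vars \<phi> \<Longrightarrow> taut (Iff (\<sigma> i) (\<tau> i))"
  shows "taut (Iff (subst \<sigma> \<phi>) (subst \<tau> \<phi>))"
  using assms by (induction \<phi>) (auto simp: taut_Iff)

lemma vars_subst: "vars (subst \<sigma> \<phi>) = (\<Union>i\<in>vars \<phi>. vars (\<sigma> i))"
  by (induction \<phi>) auto

lemma deg_subst: "(\<And>i. i \<in> vars \<phi> \<Longrightarrow> deg (\<sigma> i) = 0) \<Longrightarrow> deg (subst \<sigma> \<phi>) = deg \<phi>"
  by (induction \<phi>) auto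

lemma subst_forms:
  assumes "\<phi> \<in> forms v d" "\<And>i. i < v \<Longrightarrow> \<sigma> i \<in> forms v 0"
  shows "subst \<sigma> \<phi> \<in> forms v d"
proof -
  have "deg (subst \<sigma> \<phi>) = deg \<phi>"
    using assms by (intro deg_subst) (auto simp: forms_def)
  then show ?thesis using assms by (auto simp: forms_def vars_subst)
qed

lemma subst_subst: "subst \<tau> (subst \<sigma> \<phi>) = subst (\<lambda>i. subst \<tau> (\<sigma> i)) \<phi>"
  by (induction \<phi>) auto

lemma subst_Var: "subst Var \<phi> = \<phi>"
  by (induction \<phi>) auto

lemma K_rel_equiv: "equiv (forms v d) (K_rel v d)"
proof (rule equivI)
  show "trans (K_rel v d)"
    by (auto simp: trans_def K_rel_def K_Iff intro: K_Imp_trans)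
qed (auto simp: K_rel_def refl_on_def sym_def K_Iff K_Imp_refl)

lemma C_rel_equiv: "equiv (forms v 0) (C_rel v)"
  by (rule equivI) (auto simp only: C_rel_def refl_on_def sym_def trans_def taut_Iff)

lemma rep_in_K: "X \<in> forms v d // K_rel v d \<Longrightarrow> rep X \<in> X"
  unfolding rep_def by (metis K_rel_equiv in_quotient_imp_non_empty some_in_eq)

lemma rep_in_C: "X \<in> forms v 0 // C_rel v \<Longrightarrow> rep X \<in> X"
  unfolding rep_def by (metis C_rel_equiv in_quotient_imp_non_empty some_in_eq)

lemma K_quotient_rel:
  "X \<in> forms v d // K_rel v d \<Longrightarrow> \<phi> \<in> X \<Longrightarrow> \<psi> \<in> X \<Longrightarrow> (\<phi>, \<psi>) \<in> K_rel v d"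
  by (metis K_rel_equiv quotient_eq_iff)

lemma C_quotient_rel:
  "X \<in> forms v 0 // C_rel v \<Longrightarrow> \<phi> \<in> X \<Longrightarrow> \<psi> \<in> X \<Longrightarrow> (\<phi>, \<psi>) \<in> C_rel v"
  by (metis C_rel_equiv quotient_eq_iff)

lemma K_cls_eq: "(\<phi>, \<psi>) \<in> K_rel v d \<Longrightarrow> K_cls v d \<phi> = K_cls v d \<psi>"
  unfolding K_cls_def by (rule equiv_class_eq[OF K_rel_equiv])

lemma K_cls_carrier: "\<phi> \<in> forms v d \<Longrightarrow> K_cls v d \<phi> \<in> carrier (K_alg v d)"
  by (simp add: K_alg_def K_cls_def quotientI)

lemma K_alg_carrierE:
  assumes "X \<in> carrier (K_alg v d)"
  obtains \<phi> where "\<phi> \<in> forms v d" "X = K_cls v d \<phi>"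
  using assms by (auto simp: K_alg_def K_cls_def elim: quotientE)

lemma K_alg_le:
  assumes "\<phi> \<in> forms v d" "\<psi> \<in> forms v d"
  shows "K_cls v d \<phi> \<sqsubseteq>\<^bsub>K_alg v d\<^esub> K_cls v d \<psi> \<longleftrightarrow> Imp \<phi> \<psi> \<in> logicK"
proof
  assume "Imp \<phi> \<psi> \<in> logicK"
  moreover have "\<phi> \<in> K_cls v d \<phi>" "\<psi> \<in> K_cls v d \<psi>"
    using assms by (simp_all add: K_cls_def K_rel_def K_Iff K_Imp_refl)
  ultimately show "K_cls v d \<phi> \<sqsubseteq>\<^bsub>K_alg v d\<^esub> K_cls v d \<psi>"
    by (auto simp: K_alg_def)
next
  assume "K_cls v d \<phi> \<sqsubseteq>\<^bsub>K_alg v d\<^esub> K_cls v d \<psi>"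
  then show "Imp \<phi> \<psi> \<in> logicK"
    unfolding K_alg_def K_cls_def K_rel_def by simp (metis K_Iff K_Imp_trans)
qed

lemma K_alg_partial_order: "partial_order (K_alg v d)"
proof
  fix x y assume "x \<sqsubseteq>\<^bsub>K_alg v d\<^esub> y" "y \<sqsubseteq>\<^bsub>K_alg v d\<^esub> x"
    "x \<in> carrier (K_alg v d)" "y \<in> carrier (K_alg v d)"
  then show "x .=\<^bsub>K_alg v d\<^esub> y"
    by (auto elim!: K_alg_carrierE simp: K_alg_le)
       (simp add: K_alg_def, rule K_cls_eq, simp add: K_rel_def K_Iff)
next
  fix x y z assume "x \<sqsubseteq>\<^bsub>K_alg v d\<^esub> y" "y \<sqsubseteq>\<^bsub>K_alg v d\<^esub> z"
    "x \<in> carrier (K_alg v d)" "y \<in> carrier (K_alg v d)" "z \<in> carrier (K_alg v d)"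
  then show "x \<sqsubseteq>\<^bsub>K_alg v d\<^esub> z"
    by (auto elim!: K_alg_carrierE simp: K_alg_le intro: K_Imp_trans)
next
  fix x assume "x \<in> carrier (K_alg v d)"
  then show "x \<sqsubseteq>\<^bsub>K_alg v d\<^esub> x"
    by (auto elim!: K_alg_carrierE simp: K_alg_le K_Imp_refl)
qed (auto simp: K_alg_def)

lemma forms_simps [simp]:
  "Bot \<in> forms v d" "Var i \<in> forms v d \<longleftrightarrow> i < v"
  "Imp \<phi> \<psi> \<in> forms v d \<longleftrightarrow> \<phi> \<in> forms v d \<and> \<psi> \<in> forms v d"
  "Box \<phi> \<in> forms v (Suc d) \<longleftrightarrow> \<phi> \<in> forms v d"
  by (auto simp: forms_def)

lemma K_alg_least:
  assumes "\<phi> \<in> forms v d" "\<psi> \<in> forms v d"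
  shows "least (K_alg v d) (K_cls v d (Or \<phi> \<psi>)) (Upper (K_alg v d) {K_cls v d \<phi>, K_cls v d \<psi>})"
proof -
  have "Imp \<phi> (Or \<phi> \<psi>) \<in> logicK" "Imp \<psi> (Or \<phi> \<psi>) \<in> logicK"
    by (auto simp: taut_def intro: K_taut)
  moreover have "Imp (Or \<phi> \<psi>) \<chi> \<in> logicK" if "Imp \<phi> \<chi> \<in> logicK" "Imp \<psi> \<chi> \<in> logicK" for \<chi>
    using that by (rule K_taut2) (auto simp: taut_def)
  ultimately show ?thesis
    using assms by (auto simp: least_def Upper_def K_alg_le K_cls_carrier elim!: K_alg_carrierE)
qed

lemma K_alg_greatest:
  assumes "\<phi> \<in> forms v d" "\<psi> \<in> forms v d"
  shows "greatest (K_alg v d) (K_cls v d (And \<phi> \<psi>)) (Lower (K_alg v d) {K_cls v d \<phi>, K_cls v d \<psi>})"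
proof -
  have "Imp (And \<phi> \<psi>) \<phi> \<in> logicK" "Imp (And \<phi> \<psi>) \<psi> \<in> logicK"
    by (auto simp: taut_def intro: K_taut)
  moreover have "Imp \<chi> (And \<phi> \<psi>) \<in> logicK" if "Imp \<chi> \<phi> \<in> logicK" "Imp \<chi> \<psi> \<in> logicK" for \<chi>
    using that by (rule K_taut2) (auto simp: taut_def)
  ultimately show ?thesis
    using assms by (auto simp: greatest_def Lower_def K_alg_le K_cls_carrier elim!: K_alg_carrierE)
qed

lemma K_alg_lattice: "lattice (K_alg v d)"
proof -
  interpret partial_order "K_alg v d" by (rule K_alg_partial_order)
  show ?thesis
    by unfold_locales (blast elim: K_alg_carrierE intro: K_alg_least K_alg_greatest)+
qed

lemma K_alg_join:
  assumes "\<phi> \<in> forms v d" "\<psi> \<in> forms v d"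
  shows "K_cls v d \<phi> \<squnion>\<^bsub>K_alg v d\<^esub> K_cls v d \<psi> = K_cls v d (Or \<phi> \<psi>)"
  unfolding join_def sup_def
  by (rule some_equality, rule K_alg_least[OF assms])
     (rule partial_order.least_unique[OF K_alg_partial_order _ K_alg_least[OF assms]])

lemma K_alg_meet:
  assumes "\<phi> \<in> forms v d" "\<psi> \<in> forms v d"
  shows "K_cls v d \<phi> \<sqinter>\<^bsub>K_alg v d\<^esub> K_cls v d \<psi> = K_cls v d (And \<phi> \<psi>)"
  unfolding meet_def inf_def
  by (rule some_equality, rule K_alg_greatest[OF assms])
     (rule partial_order.greatest_unique[OF K_alg_partial_order _ K_alg_greatest[OF assms]])

lemma rep_subst_forms:
  assumes "S \<in> carrier (subst_monoid v)" "i < v"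
  shows "rep (S i) \<in> forms v 0"
proof -
  have S: "S i \<in> forms v 0 // C_rel v" using assms by (auto simp: subst_monoid_def)
  then show ?thesis using C_quotient_rel[OF S rep_in_C[OF S] rep_in_C[OF S]] by (simp add: C_rel_def)
qed

lemma rep_subst_rel:
  assumes "S \<in> carrier (subst_monoid v)" "i < v" "\<phi> \<in> S i"
  shows "(rep (S i), \<phi>) \<in> C_rel v"
proof -
  have S: "S i \<in> forms v 0 // C_rel v" using assms by (auto simp: subst_monoid_def)
  show ?thesis by (rule C_quotient_rel[OF S rep_in_C[OF S] assms(3)])
qed

lemma K_act_cls:
  assumes S: "S \<in> carrier (subst_monoid v)" and \<sigma>: "\<And>i. i < v \<Longrightarrow> \<sigma> i \<in> S i"
    and \<phi>: "\<phi> \<in> forms v d"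
  shows "K_act v d S (K_cls v d \<phi>) = K_cls v d (subst \<sigma> \<phi>)"
proof -
  let ?r = "\<lambda>i. rep (S i)" and ?X = "K_cls v d \<phi>"
  have C: "(?r i, \<sigma> i) \<in> C_rel v" if "i < v" for i
    using that S \<sigma> by (auto intro: rep_subst_rel)
  have X: "?X \<in> forms v d // K_rel v d" using \<phi> by (simp add: K_cls_def quotientI)
  have "\<phi> \<in> ?X" using \<phi> by (simp add: K_cls_def K_rel_def K_Iff K_Imp_refl)
  then have R: "(rep ?X, \<phi>) \<in> K_rel v d" using K_quotient_rel[OF X rep_in_K[OF X]] by blast
  have "subst ?r (Iff (rep ?X) \<phi>) \<in> logicK"
    using R by (intro K_subst) (simp add: K_rel_def)
  then have 1: "Iff (subst ?r (rep ?X)) (subst ?r \<phi>) \<in> logicK" by simp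
  have 2: "Iff (subst ?r \<phi>) (subst \<sigma> \<phi>) \<in> logicK"
    using C \<phi> by (intro K_subst_cong K_taut) (auto simp: C_rel_def forms_def)
  have "Iff (subst ?r (rep ?X)) (subst \<sigma> \<phi>) \<in> logicK"
    using 1 2 unfolding K_Iff by (blast intro: K_Imp_trans)
  moreover have "subst ?r (rep ?X) \<in> forms v d" "subst \<sigma> \<phi> \<in> forms v d"
    using R \<phi> C by (auto intro!: subst_forms simp: K_rel_def C_rel_def)
  ultimately show ?thesis
    unfolding K_act_def by (intro K_cls_eq) (simp add: K_rel_def)
qed

lemma subst_mult:
  assumes S: "S \<in> carrier (subst_monoid v)" and T: "T \<in> carrier (subst_monoid v)"
    and \<sigma>: "\<And>i. i < v \<Longrightarrow> \<sigma> i \<in> S i" and \<tau>: "\<And>i. i < v \<Longrightarrow> \<tau> i \<in> T i"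
  shows "S \<otimes>\<^bsub>subst_monoid v\<^esub> T = (\<lambda>i\<in>{..<v}. C_rel v `` {subst \<tau> (\<sigma> i)})"
proof -
  let ?s = "\<lambda>i. rep (S i)" and ?t = "\<lambda>i. rep (T i)"
  have C: "(?s i, \<sigma> i) \<in> C_rel v" "(?t i, \<tau> i) \<in> C_rel v" if "i < v" for i
    using that S T \<sigma> \<tau> by (auto intro: rep_subst_rel)
  have "C_rel v `` {subst ?t (?s i)} = C_rel v `` {subst \<tau> (\<sigma> i)}" if i: "i < v" for i
  proof (rule equiv_class_eq[OF C_rel_equiv])
    have "taut (subst ?t (Iff (?s i) (\<sigma> i)))"
      using C(1)[OF i] by (intro taut_subst) (simp add: C_rel_def)
    moreover have "taut (Iff (subst ?t (\<sigma> i)) (subst \<tau> (\<sigma> i)))"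
      using C(1)[OF i] C(2) by (intro taut_subst_cong) (auto simp: C_rel_def forms_def)
    ultimately have "taut (Iff (subst ?t (?s i)) (subst \<tau> (\<sigma> i)))"
      by (auto simp only: subst.simps taut_Iff)
    moreover have "subst ?t (?s i) \<in> forms v 0" "subst \<tau> (\<sigma> i) \<in> forms v 0"
      using C(1)[OF i] C(2) by (auto intro!: subst_forms simp: C_rel_def)
    ultimately show "(subst ?t (?s i), subst \<tau> (\<sigma> i)) \<in> C_rel v"
      by (simp add: C_rel_def)
  qed
  then show ?thesis by (auto simp: subst_monoid_def intro!: restrict_ext)
qed

lemma C_cls_self: "\<phi> \<in> forms v 0 \<Longrightarrow> \<phi> \<in> C_rel v `` {\<phi>}"
  by (rule equiv_class_self[OF C_rel_equiv])

lemma subst_monoidI: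
  "(\<And>i. i < v \<Longrightarrow> \<sigma> i \<in> forms v 0) \<Longrightarrow>
   (\<lambda>i\<in>{..<v}. C_rel v `` {\<sigma> i}) \<in> carrier (subst_monoid v)"
  by (auto simp: subst_monoid_def intro: quotientI)

lemma subst_monoidE:
  assumes "S \<in> carrier (subst_monoid v)"
  obtains \<sigma> where "\<And>i. i < v \<Longrightarrow> \<sigma> i \<in> forms v 0" "S = (\<lambda>i\<in>{..<v}. C_rel v `` {\<sigma> i})"
proof
  show "rep (S i) \<in> forms v 0" if "i < v" for i
    using rep_subst_forms[OF assms that] .
  show "S = (\<lambda>i\<in>{..<v}. C_rel v `` {rep (S i)})"
  proof
    fix i
    show "S i = (\<lambda>i\<in>{..<v}. C_rel v `` {rep (S i)}) i"
    proof (cases "i < v")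
      case True
      then have S: "S i \<in> forms v 0 // C_rel v" using assms by (auto simp: subst_monoid_def)
      then obtain \<phi> where "\<phi> \<in> forms v 0" "S i = C_rel v `` {\<phi>}" by (elim quotientE)
      moreover from this rep_in_C[OF S] have "(\<phi>, rep (S i)) \<in> C_rel v" by blast
      ultimately have "S i = C_rel v `` {rep (S i)}"
        using equiv_class_eq[OF C_rel_equiv, of \<phi> "rep (S i)" v] by metis
      moreover have "(\<lambda>i\<in>{..<v}. C_rel v `` {rep (S i)}) i = C_rel v `` {rep (S i)}"
        using True by simp
      ultimately show ?thesis by (rule trans[OF _ sym])
    next
      case False
      then show ?thesis using assms by (auto simp: subst_monoid_def PiE_iff extensional_def)
    qed
  qed
qed

lemma subst_mult_cls:
  assumes "\<And>i. i < v \<Longrightarrow> \<sigma> i \<in> forms v 0" "\<And>i. i < v \<Longrightarrow> \<tau> i \<in> forms v 0"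
  shows "(\<lambda>i\<in>{..<v}. C_rel v `` {\<sigma> i}) \<otimes>\<^bsub>subst_monoid v\<^esub> (\<lambda>i\<in>{..<v}. C_rel v `` {\<tau> i}) =
         (\<lambda>i\<in>{..<v}. C_rel v `` {subst \<tau> (\<sigma> i)})"
  by (intro subst_mult subst_monoidI) (use assms C_cls_self in simp_all)

lemma subst_monoid_one: "\<one>\<^bsub>subst_monoid v\<^esub> = (\<lambda>i\<in>{..<v}. C_rel v `` {Var i})"
  by (simp add: subst_monoid_def)

lemma subst_monoid_monoid: "monoid (subst_monoid v)"
proof
  fix x y assume x: "x \<in> carrier (subst_monoid v)" and y: "y \<in> carrier (subst_monoid v)"
  obtain \<sigma> where
    \<sigma>: "\<And>i. i < v \<Longrightarrow> \<sigma> i \<in> forms v 0" "x = (\<lambda>i\<in>{..<v}. C_rel v `` {\<sigma> i})"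
    using x by (rule subst_monoidE) blast
  obtain \<tau> where
    \<tau>: "\<And>i. i < v \<Longrightarrow> \<tau> i \<in> forms v 0" "y = (\<lambda>i\<in>{..<v}. C_rel v `` {\<tau> i})"
    using y by (rule subst_monoidE) blast
  show "x \<otimes>\<^bsub>subst_monoid v\<^esub> y \<in> carrier (subst_monoid v)"
    unfolding \<sigma>(2) \<tau>(2)
    by (subst subst_mult_cls) (auto simp: \<sigma>(1) \<tau>(1) intro!: subst_monoidI subst_forms)
next
  show "\<one>\<^bsub>subst_monoid v\<^esub> \<in> carrier (subst_monoid v)"
    unfolding subst_monoid_one by (rule subst_monoidI) simp
next
  fix x assume x: "x \<in> carrier (subst_monoid v)"
  obtain \<sigma> where
    \<sigma>: "\<And>i. i < v \<Longrightarrow> \<sigma> i \<in> forms v 0" "x = (\<lambda>i\<in>{..<v}. C_rel v `` {\<sigma> i})"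
    using x by (rule subst_monoidE) blast
  show "\<one>\<^bsub>subst_monoid v\<^esub> \<otimes>\<^bsub>subst_monoid v\<^esub> x = x"
    unfolding \<sigma>(2) subst_monoid_one by (subst subst_mult_cls) (simp_all add: \<sigma>(1))
  show "x \<otimes>\<^bsub>subst_monoid v\<^esub> \<one>\<^bsub>subst_monoid v\<^esub> = x"
    unfolding \<sigma>(2) subst_monoid_one by (subst subst_mult_cls) (simp_all add: \<sigma>(1) subst_Var)
next
  fix x y z
  assume x: "x \<in> carrier (subst_monoid v)" and y: "y \<in> carrier (subst_monoid v)"
    and z: "z \<in> carrier (subst_monoid v)"
  obtain \<sigma> where
    \<sigma>: "\<And>i. i < v \<Longrightarrow> \<sigma> i \<in> forms v 0" "x = (\<lambda>i\<in>{..<v}. C_rel v `` {\<sigma> i})"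
    using x by (rule subst_monoidE) blast
  obtain \<tau> where
    \<tau>: "\<And>i. i < v \<Longrightarrow> \<tau> i \<in> forms v 0" "y = (\<lambda>i\<in>{..<v}. C_rel v `` {\<tau> i})"
    using y by (rule subst_monoidE) blast
  obtain \<rho> where
    \<rho>: "\<And>i. i < v \<Longrightarrow> \<rho> i \<in> forms v 0" "z = (\<lambda>i\<in>{..<v}. C_rel v `` {\<rho> i})"
    using z by (rule subst_monoidE) blast
  have \<sigma>\<tau>: "subst \<tau> (\<sigma> i) \<in> forms v 0" and \<tau>\<rho>: "subst \<rho> (\<tau> i) \<in> forms v 0" if "i < v" for i
    using that by (auto simp: \<sigma>(1) \<tau>(1) \<rho>(1) intro!: subst_forms)
  show "x \<otimes>\<^bsub>subst_monoid v\<^esub> y \<otimes>\<^bsub>subst_monoid v\<^esub> z =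
        x \<otimes>\<^bsub>subst_monoid v\<^esub> (y \<otimes>\<^bsub>subst_monoid v\<^esub> z)"
    unfolding \<sigma>(2) \<tau>(2) \<rho>(2)
    by (simp add: subst_mult_cls \<sigma>(1) \<tau>(1) \<rho>(1) \<sigma>\<tau> \<tau>\<rho> subst_subst)
qed

lemma prime_substs_group: "group (prime_substs v)"
  unfolding prime_substs_def by (rule monoid.units_group[OF subst_monoid_monoid])

lemma Conj_forms: "Conj \<phi>s \<in> forms v d \<longleftrightarrow> set \<phi>s \<subseteq> forms v d"
  by (induction \<phi>s) (auto simp: Conj_def)

lemma set_signed_conjs:
  "set (signed_conjs \<phi>s) = {Conj (map2 lit bs \<phi>s) | bs. length bs = length \<phi>s}"
  by (auto simp: signed_conjs_def set_n_lists)

lemma signed_conjs_forms: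
  assumes "set \<phi>s \<subseteq> forms v d" "c \<in> set (signed_conjs \<phi>s)"
  shows "c \<in> forms v d"
  using assms by (fastforce simp: set_signed_conjs Conj_forms lit_def dest!: set_zip_rightD)

lemma minterm_list_forms: "set (minterm_list v d) \<subseteq> forms v d"
proof (induction d)
  case 0
  have "set (map Var [0..<v]) \<subseteq> forms v 0" by auto
  from signed_conjs_forms[OF this] show ?case by auto
next
  case (Suc d)
  have "set (map Var [0..<v]) \<subseteq> forms v (Suc d)"
    "set (map Dia (minterm_list v d)) \<subseteq> forms v (Suc d)"
    using Suc by auto
  from this[THEN signed_conjs_forms] show ?case by auto
qed

end

theory Submission
  imports Defs
begin

text \<open>
  An invertible \<open>s\<close> with inverse \<open>t\<close> acts on classes with inverse action \<open>t\<close>, and substitution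
  commutes with the connectives; this is part (b). For part (a) one shows by induction on the level
  that \<open>s\<close> permutes the list of minterms up to provable equivalence. At level 0 the minterm of a
  valuation \<open>A\<close> goes to the minterm of the valuation induced by \<open>A\<close> and \<open>t\<close>; at level \<open>d + 1\<close> a
  permutation of the level-\<open>d\<close> minterms induces one of their sign patterns. Permuting the minterms
  as formulas, rather than as classes, means that their consistency in K is never needed.
\<close>

section \<open>Permutations up to provable equivalence\<close>

definition permuted_by :: "(nat \<Rightarrow> fm) \<Rightarrow> fm set \<Rightarrow> bool" where
  "permuted_by s X \<longleftrightarrow> (\<exists>\<pi>. bij_betw \<pi> X X \<and> (\<forall>\<phi>\<in>X. Iff (subst s \<phi>) (\<pi> \<phi>) \<in> logicK))"

text \<open>An injective encoding \<open>e\<close> lets a permutation be built on an index set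
  \<open>Y\<close>, such as sets of positive conjuncts or pairs, and carried to formulas by
  conjugation with \<open>e\<close>.\<close>

lemma permuted_by_image:
  assumes e: "inj_on e Y" and \<theta>: "bij_betw \<theta> Y Y"
    and eq: "\<And>y. y \<in> Y \<Longrightarrow> Iff (subst s (e y)) (e (\<theta> y)) \<in> logicK"
  shows "permuted_by s (e ` Y)"
  unfolding permuted_by_def
proof (intro exI conjI ballI)
  have e': "bij_betw e Y (e ` Y)"
    using e by (rule inj_on_imp_bij_betw)
  show "bij_betw (e \<circ> \<theta> \<circ> the_inv_into Y e) (e ` Y) (e ` Y)"
    using bij_betw_the_inv_into[OF e'] \<theta> e' by (blast intro: bij_betw_trans)
  show "Iff (subst s \<phi>) ((e \<circ> \<theta> \<circ> the_inv_into Y e) \<phi>) \<in> logicK" if "\<phi> \<in> e ` Y" for \<phi>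
    using that eq by (auto simp: the_inv_into_f_f[OF e])
qed

text \<open>Substitution changes all conjuncts of a minterm at once, so classical consequences of
  arbitrarily many theorems are needed.\<close>

lemma K_taut_list:
  assumes "set \<Gamma> \<subseteq> logicK" "\<And>V. \<forall>\<gamma>\<in>set \<Gamma>. tval V \<gamma> \<Longrightarrow> tval V \<chi>"
  shows "\<chi> \<in> logicK"
  using assms
proof (induction \<Gamma> arbitrary: \<chi>)
  case Nil
  then show ?case by (auto intro: K_taut simp: taut_def)
next
  case (Cons \<gamma> \<Gamma>)
  \<comment> \<open>The head premise moves into the conclusion, hence the generalisation over
    \<open>\<chi>\<close>.\<close>
  have "Imp \<gamma> \<chi> \<in> logicK"
    using Cons.prems by (intro Cons.IH) auto
  then show ?case
    using Cons.prems(1) by (auto intro: K_mp[of \<gamma>])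
qed

section \<open>Signed conjunctions, indexed by their positive conjuncts\<close>

lemma tval_Conj: "tval V (Conj \<phi>s) \<longleftrightarrow> (\<forall>\<phi>\<in>set \<phi>s. tval V \<phi>)"
  by (induction \<phi>s) (auto simp: Conj_def)

lemma subst_Conj: "subst s (Conj \<phi>s) = Conj (map (subst s) \<phi>s)"
  by (induction \<phi>s) (auto simp: Conj_def)

lemma tval_lit: "tval V (lit b \<phi>) \<longleftrightarrow> tval V \<phi> = b"
  by (auto simp: lit_def)

lemma subst_lit: "subst s (lit b \<phi>) = lit b (subst s \<phi>)"
  by (auto simp: lit_def)

text \<open>A formula is a proper subformula of its negation, so the sign of a literal can be read
  off syntactically.\<close>

lemma lit_inject: "lit b \<phi> = lit c \<phi> \<longleftrightarrow> b = c"
proof -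
  have "\<phi> \<noteq> Neg \<phi>"
    by (induction \<phi>) auto
  then show ?thesis
    by (auto simp: lit_def dest: sym)
qed

lemma Conj_inject: "length \<phi>s = length \<psi>s \<Longrightarrow> Conj \<phi>s = Conj \<psi>s \<longleftrightarrow> \<phi>s = \<psi>s"
  by (induction \<phi>s \<psi>s rule: list_induct2) (auto simp: Conj_def)

text \<open>Signs are recorded by the set \<open>A\<close> of positive conjuncts in place of a
  Boolean list, so that a permutation of the conjuncts acts on the index by taking images.\<close>

definition sign_conj :: "fm list \<Rightarrow> fm set \<Rightarrow> fm" where
  "sign_conj \<phi>s A = Conj (map (\<lambda>\<phi>. lit (\<phi> \<in> A) \<phi>) \<phi>s)"

lemma tval_subst_sign_conj:
  "tval V (subst s (sign_conj \<phi>s A)) \<longleftrightarrow> (\<forall>\<phi>\<in>set \<phi>s. tval V (subst s \<phi>) = (\<phi> \<in> A))"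
  by (auto simp: sign_conj_def subst_Conj tval_Conj subst_lit tval_lit)

lemma tval_sign_conj:
  "tval V (sign_conj \<phi>s A) \<longleftrightarrow> (\<forall>\<phi>\<in>set \<phi>s. tval V \<phi> = (\<phi> \<in> A))"
  using tval_subst_sign_conj[of V Var] by (simp add: subst_Var)

lemma inj_on_sign_conj: "inj_on (sign_conj \<phi>s) (Pow (set \<phi>s))"
  by (rule inj_onI) (auto simp: sign_conj_def Conj_inject lit_inject)

text \<open>A repeated entry could receive both signs, which no set of positive entries describes;
  distinctness excludes this.\<close>

lemma set_signed_conjs_distinct:
  assumes "distinct \<phi>s"
  shows "set (signed_conjs \<phi>s) = sign_conj \<phi>s ` Pow (set \<phi>s)"
proof
  show "set (signed_conjs \<phi>s) \<subseteq> sign_conj \<phi>s ` Pow (set \<phi>s)"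
  proof
    fix c assume "c \<in> set (signed_conjs \<phi>s)"
    then obtain bs where len: "length bs = length \<phi>s" and c: "c = Conj (map2 lit bs \<phi>s)"
      by (auto simp: set_signed_conjs)
    define A where "A = {\<phi>s ! i | i. i < length \<phi>s \<and> bs ! i}"
    have "\<phi>s ! i \<in> A \<longleftrightarrow> bs ! i" if "i < length \<phi>s" for i
      using that assms by (auto simp: A_def nth_eq_iff_index_eq)
    then have "map2 lit bs \<phi>s = map (\<lambda>\<phi>. lit (\<phi> \<in> A) \<phi>) \<phi>s"
      using len by (auto intro!: nth_equalityI)
    then have "c = sign_conj \<phi>s A"
      by (simp add: c sign_conj_def)
    moreover have "A \<subseteq> set \<phi>s"
      by (auto simp: A_def)
    ultimately show "c \<in> sign_conj \<phi>s ` Pow (set \<phi>s)"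
      by blast
  qed
  show "sign_conj \<phi>s ` Pow (set \<phi>s) \<subseteq> set (signed_conjs \<phi>s)"
  proof (clarsimp simp: set_signed_conjs)
    fix A
    have "map2 lit (map (\<lambda>\<phi>. \<phi> \<in> A) \<phi>s) \<phi>s = map (\<lambda>\<phi>. lit (\<phi> \<in> A) \<phi>) \<phi>s"
      by (auto intro!: nth_equalityI)
    then show "\<exists>bs. sign_conj \<phi>s A = Conj (map2 lit bs \<phi>s) \<and> length bs = length \<phi>s"
      by (intro exI[of _ "map (\<lambda>\<phi>. \<phi> \<in> A) \<phi>s"]) (simp add: sign_conj_def)
  qed
qed

text \<open>Equal conjunctions have equal literals position by position, hence equal signs.\<close>

lemma distinct_signed_conjs: "distinct (signed_conjs \<phi>s)"
proof -
  have "inj_on (\<lambda>bs. Conj (map2 lit bs \<phi>s)) {bs. length bs = length \<phi>s}"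
  proof (rule inj_onI, clarsimp simp: Conj_inject)
    fix bs cs :: "bool list"
    assume "map2 lit bs \<phi>s = map2 lit cs \<phi>s" "length bs = length \<phi>s" "length cs = length \<phi>s"
    then show "bs = cs"
      by (auto simp: list_eq_iff_nth_eq lit_inject)
  qed
  then show ?thesis
    by (auto simp: signed_conjs_def distinct_map distinct_n_lists set_n_lists
        intro: inj_on_subset)
qed

lemma set_minterm_list_Suc:
  "set (minterm_list v (Suc d)) =
   (\<lambda>(m, c). And m c) ` (set (minterm_list v 0) \<times> set (signed_conjs (map Dia (minterm_list v d))))"
  by auto

text \<open>A case split is enough, since \<open>distinct_signed_conjs\<close> applies to any list
  and pairing by \<open>And\<close> is injective.\<close>

lemma distinct_minterm_list: "distinct (minterm_list v d)"
proof (cases d)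
  case 0
  then show ?thesis by (simp add: distinct_signed_conjs)
next
  case (Suc e)
  have eq: "minterm_list v d = map (\<lambda>(m, c). And m c)
      (List.product (minterm_list v 0) (signed_conjs (map Dia (minterm_list v e))))"
    by (simp add: Suc product_concat_map map_concat comp_def)
  show ?thesis
    unfolding eq by (auto simp: distinct_map distinct_product distinct_signed_conjs inj_on_def)
qed

section \<open>Permutations carried through the minterm construction\<close>

lemma permuted_by_signed_conjs:
  assumes "distinct \<phi>s" and "permuted_by s (set \<phi>s)"
  shows "permuted_by s (set (signed_conjs \<phi>s))"
proof -
  obtain \<pi> where \<pi>: "bij_betw \<pi> (set \<phi>s) (set \<phi>s)"
    and eq: "\<And>\<phi>. \<phi> \<in> set \<phi>s \<Longrightarrow> Iff (subst s \<phi>) (\<pi> \<phi>) \<in> logicK"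
    using assms(2) by (auto simp: permuted_by_def)
  have "Iff (subst s (sign_conj \<phi>s A)) (sign_conj \<phi>s (\<pi> ` A)) \<in> logicK" if A: "A \<in> Pow (set \<phi>s)" for A
  proof (rule K_taut_list)
    show "set (map (\<lambda>\<phi>. Iff (subst s \<phi>) (\<pi> \<phi>)) \<phi>s) \<subseteq> logicK"
      using eq by auto
    fix V assume "\<forall>\<gamma>\<in>set (map (\<lambda>\<phi>. Iff (subst s \<phi>) (\<pi> \<phi>)) \<phi>s). tval V \<gamma>"
    then have V: "tval V (subst s \<phi>) = tval V (\<pi> \<phi>)" if "\<phi> \<in> set \<phi>s" for \<phi>
      using that by auto
    \<comment> \<open>By injectivity of \<open>\<pi>\<close>, no conjunct outside \<open>A\<close>
      is mapped into the image of \<open>A\<close>.\<close>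
    have mem: "\<pi> \<phi> \<in> \<pi> ` A \<longleftrightarrow> \<phi> \<in> A" if "\<phi> \<in> set \<phi>s" for \<phi>
      using that A \<pi> by (auto simp: bij_betw_def dest: inj_onD)
    \<comment> \<open>Surjectivity of \<open>\<pi>\<close> lets the conjuncts be listed as images
      under \<open>\<pi>\<close>.\<close>
    have "tval V (sign_conj \<phi>s (\<pi> ` A)) \<longleftrightarrow> (\<forall>\<phi>\<in>\<pi> ` set \<phi>s. tval V \<phi> = (\<phi> \<in> \<pi> ` A))"
      using \<pi> by (simp add: tval_sign_conj bij_betw_def)
    also have "\<dots> \<longleftrightarrow> (\<forall>\<phi>\<in>set \<phi>s. tval V (subst s \<phi>) = (\<phi> \<in> A))"
      using V mem by auto
    also have "\<dots> \<longleftrightarrow> tval V (subst s (sign_conj \<phi>s A))"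
      by (simp add: tval_subst_sign_conj)
    finally show "tval V (Iff (subst s (sign_conj \<phi>s A)) (sign_conj \<phi>s (\<pi> ` A)))"
      by simp
  qed
  then show ?thesis
    unfolding set_signed_conjs_distinct[OF assms(1)]
    by (intro permuted_by_image[where \<theta> = "image \<pi>"] inj_on_sign_conj bij_betw_Pow \<pi>)
qed

lemma K_Dia_cong:
  assumes "Iff \<phi> \<psi> \<in> logicK"
  shows "Iff (Dia \<phi>) (Dia \<psi>) \<in> logicK"
  \<comment> \<open>\<open>Var 0\<close> marks the hole of the context \<open>Dia\<close>.\<close>
  using K_subst_cong[of "Dia (Var 0)" "\<lambda>_. \<phi>" "\<lambda>_. \<psi>"] assms by simp

lemma permuted_by_Dia:
  assumes "permuted_by s X"
  shows "permuted_by s (Dia ` X)"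
proof -
  obtain \<pi> where "bij_betw \<pi> X X" "\<And>\<phi>. \<phi> \<in> X \<Longrightarrow> Iff (subst s \<phi>) (\<pi> \<phi>) \<in> logicK"
    using assms by (auto simp: permuted_by_def)
  then show ?thesis
    using K_Dia_cong by (intro permuted_by_image) (auto simp: inj_on_def)
qed

lemma permuted_by_And:
  assumes "permuted_by s X" "permuted_by s Y"
  shows "permuted_by s ((\<lambda>(m, c). And m c) ` (X \<times> Y))"
proof -
  obtain \<pi> where \<pi>: "bij_betw \<pi> X X" "\<And>\<phi>. \<phi> \<in> X \<Longrightarrow> Iff (subst s \<phi>) (\<pi> \<phi>) \<in> logicK"
    using assms(1) by (auto simp: permuted_by_def)
  obtain \<rho> where \<rho>: "bij_betw \<rho> Y Y" "\<And>\<phi>. \<phi> \<in> Y \<Longrightarrow> Iff (subst s \<phi>) (\<rho> \<phi>) \<in> logicK"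
    using assms(2) by (auto simp: permuted_by_def)
  show ?thesis
  proof (rule permuted_by_image)
    show "bij_betw (map_prod \<pi> \<rho>) (X \<times> Y) (X \<times> Y)"
      using \<pi>(1) \<rho>(1) by (rule bij_betw_map_prod)
    fix y assume y: "y \<in> X \<times> Y"
    then have "Iff (subst s (fst y)) (\<pi> (fst y)) \<in> logicK" "Iff (subst s (snd y)) (\<rho> (snd y)) \<in> logicK"
      using \<pi>(2) \<rho>(2) by auto
    then have "Iff (And (subst s (fst y)) (subst s (snd y))) (And (\<pi> (fst y)) (\<rho> (snd y))) \<in> logicK"
      by (rule K_taut2) (auto simp: taut_def)
    then show "Iff (subst s (case y of (m, c) \<Rightarrow> And m c))
        (case map_prod \<pi> \<rho> y of (m, c) \<Rightarrow> And m c) \<in> logicK"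
      by (simp add: case_prod_beta)
  qed (auto simp: inj_on_def)
qed

section \<open>Level 0: the action on valuations\<close>

lemma tval_cong_forms0:
  assumes "\<phi> \<in> forms v 0" "\<And>i. i < v \<Longrightarrow> V (Var i) = W (Var i)"
  shows "tval V \<phi> = tval W \<phi>"
  using assms by (induction \<phi>) (auto simp: forms_def)

text \<open>A valuation is coded by its set of true variables, matching the index of
  \<open>sign_conj\<close>; this is the pullback of the valuation \<open>A\<close> along the
  substitution \<open>r\<close>.\<close>

definition induced_val :: "nat \<Rightarrow> (nat \<Rightarrow> fm) \<Rightarrow> fm set \<Rightarrow> fm set" where
  "induced_val v r A = {Var i | i. i < v \<and> tval (\<lambda>\<chi>. \<chi> \<in> A) (r i)}"

text \<open>The assumptions are symmetric, so every fact is also available with \<open>s\<close> and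
  \<open>t\<close> exchanged.\<close>

locale inverse_substs =
  fixes v :: nat and s t :: "nat \<Rightarrow> fm"
  assumes s_forms: "i < v \<Longrightarrow> s i \<in> forms v 0"
    and t_forms: "i < v \<Longrightarrow> t i \<in> forms v 0"
    and ts: "i < v \<Longrightarrow> taut (Iff (subst t (s i)) (Var i))"
    and st: "i < v \<Longrightarrow> taut (Iff (subst s (t i)) (Var i))"
begin

lemma inverse_substs_sym: "inverse_substs v t s"
  using s_forms t_forms ts st by unfold_locales

text \<open>Evaluating \<open>s i\<close> under the valuation induced by \<open>t\<close> amounts to
  evaluating \<open>subst t (s i)\<close> under \<open>A\<close>, and that formula is equivalent to
  \<open>Var i\<close>.\<close>

lemma induced_val_inverse:
  assumes A: "A \<subseteq> Var ` {..<v}"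
  shows "induced_val v s (induced_val v t A) = A"
proof -
  have "tval (\<lambda>\<chi>. \<chi> \<in> induced_val v t A) (s i) \<longleftrightarrow> Var i \<in> A" if i: "i < v" for i
  proof -
    have "tval (\<lambda>\<chi>. \<chi> \<in> induced_val v t A) (s i) = tval (\<lambda>\<chi>. \<chi> \<in> A) (subst t (s i))"
      unfolding tval_subst using s_forms[OF i]
      by (rule tval_cong_forms0) (auto simp: induced_val_def)
    also have "\<dots> \<longleftrightarrow> Var i \<in> A"
      using ts[OF i] by (simp only: taut_Iff tval.simps)
    finally show ?thesis .
  qed
  then show ?thesis
    using A unfolding induced_val_def[of v s] by auto
qed

lemma induced_val_inverse':
  assumes "A \<subseteq> Var ` {..<v}"
  shows "induced_val v t (induced_val v s A) = A"
  by (rule inverse_substs.induced_val_inverse[OF inverse_substs_sym assms])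

text \<open>A valuation \<open>B\<close> satisfies the substituted minterm of \<open>A\<close>
  exactly when \<open>induced_val v s B = A\<close>. Solving for \<open>B\<close> brings in the
  inverse \<open>t\<close>.\<close>

lemma permuted_by_minterm_list_0: "permuted_by s (set (minterm_list v 0))"
proof -
  let ?ps = "map Var [0..<v]"
  have ps: "set ?ps = Var ` {..<v}"
    by auto
  have val: "induced_val v r A \<subseteq> Var ` {..<v}" for r A
    by (auto simp: induced_val_def)
  have "bij_betw (induced_val v t) (Pow (set ?ps)) (Pow (set ?ps))"
    unfolding ps
    by (rule bij_betw_byWitness[where f' = "induced_val v s"])
       (use val induced_val_inverse induced_val_inverse' in auto)
  moreover have "Iff (subst s (sign_conj ?ps A)) (sign_conj ?ps (induced_val v t A)) \<in> logicK"
    if "A \<in> Pow (set ?ps)" for A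
  proof (rule K_taut, unfold taut_Iff, rule allI)
    fix V
    have A: "A \<subseteq> Var ` {..<v}"
      using that ps by auto
    \<comment> \<open>\<open>B\<close> codes the restriction of \<open>V\<close> to the variables
      below \<open>v\<close>.\<close>
    define B where "B = {Var i | i. i < v \<and> V (Var i)}"
    have B: "B \<subseteq> Var ` {..<v}"
      by (auto simp: B_def)
    have sB: "Var i \<in> induced_val v s B \<longleftrightarrow> tval V (s i)" if "i < v" for i
      using that tval_cong_forms0[OF s_forms[OF that], of V "\<lambda>\<chi>. \<chi> \<in> B"]
      by (auto simp: induced_val_def B_def)
    have "tval V (subst s (sign_conj ?ps A)) \<longleftrightarrow> (\<forall>i<v. tval V (s i) = (Var i \<in> A))"
      by (auto simp: tval_subst_sign_conj)
    also have "\<dots> \<longleftrightarrow> induced_val v s B = A"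
      using A val[of s B] sB by blast
    also have "\<dots> \<longleftrightarrow> B = induced_val v t A"
      using induced_val_inverse[OF A] induced_val_inverse'[OF B] by metis
    also have "\<dots> \<longleftrightarrow> (\<forall>i<v. V (Var i) = (Var i \<in> induced_val v t A))"
      using val[of t A] unfolding B_def by blast
    also have "\<dots> \<longleftrightarrow> tval V (sign_conj ?ps (induced_val v t A))"
      by (auto simp: tval_sign_conj)
    finally show "tval V (subst s (sign_conj ?ps A)) = tval V (sign_conj ?ps (induced_val v t A))" .
  qed
  moreover have "set (minterm_list v 0) = sign_conj ?ps ` Pow (set ?ps)"
    unfolding minterm_list.simps by (rule set_signed_conjs_distinct) (simp add: distinct_map inj_on_def)
  ultimately show ?thesis
    using permuted_by_image[OF inj_on_sign_conj] by metis
qed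

lemma permuted_by_minterm_list: "permuted_by s (set (minterm_list v d))"
proof (induction d)
  case 0
  show ?case by (rule permuted_by_minterm_list_0)
next
  case (Suc d)
  \<comment> \<open>Since \<open>Dia\<close> is injective, the list of diamonds inherits
    distinctness from the minterm list.\<close>
  have "permuted_by s (set (signed_conjs (map Dia (minterm_list v d))))"
    using permuted_by_Dia[OF Suc] distinct_minterm_list
    by (intro permuted_by_signed_conjs) (auto simp: distinct_map inj_on_def)
  then show ?case
    unfolding set_minterm_list_Suc by (intro permuted_by_And permuted_by_minterm_list_0)
qed

text \<open>The permutation supplies a minterm equivalent to the substituted one; bijectivity on
  classes will come from the inverse action.\<close>

lemma subst_minterm:
  assumes "\<mu> \<in> set (minterm_list v d)"
  shows "K_cls v d (subst s \<mu>) \<in> minterms v d"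
proof -
  obtain \<nu> where \<nu>: "\<nu> \<in> set (minterm_list v d)" "Iff (subst s \<mu>) \<nu> \<in> logicK"
    using permuted_by_minterm_list assms unfolding permuted_by_def by (meson bij_betwE)
  then have "K_cls v d (subst s \<mu>) = K_cls v d \<nu>"
    using assms minterm_list_forms[of v d] s_forms
    by (intro K_cls_eq) (auto simp: K_rel_def intro!: subst_forms)
  then show ?thesis
    using \<nu>(1) by (simp add: minterms_def)
qed

lemma K_cls_subst_subst:
  assumes "\<phi> \<in> forms v d"
  shows "K_cls v d (subst t (subst s \<phi>)) = K_cls v d \<phi>"
proof -
  \<comment> \<open>Writing \<open>\<phi>\<close> as \<open>subst Var \<phi>\<close> turns the claim
    into a comparison of two substitutions on \<open>\<phi>\<close>.\<close>
  have "Iff (subst (\<lambda>i. subst t (s i)) \<phi>) (subst Var \<phi>) \<in> logicK"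
    using assms ts by (intro K_subst_cong K_taut) (auto simp: forms_def)
  then show ?thesis
    using assms s_forms t_forms
    by (intro K_cls_eq) (auto simp: K_rel_def subst_subst subst_Var intro!: subst_forms)
qed

end

section \<open>From representatives to classes\<close>

lemma prime_subst_inverse:
  assumes "\<sigma> \<in> carrier (prime_substs v)"
  obtains \<tau> where "\<sigma> \<in> carrier (subst_monoid v)" "\<tau> \<in> carrier (subst_monoid v)"
    "inverse_substs v (\<lambda>i. rep (\<sigma> i)) (\<lambda>i. rep (\<tau> i))"
proof -
  obtain \<tau> where \<sigma>: "\<sigma> \<in> carrier (subst_monoid v)" and \<tau>: "\<tau> \<in> carrier (subst_monoid v)"
    and eq: "\<tau> \<otimes>\<^bsub>subst_monoid v\<^esub> \<sigma> = \<one>\<^bsub>subst_monoid v\<^esub>"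
      "\<sigma> \<otimes>\<^bsub>subst_monoid v\<^esub> \<tau> = \<one>\<^bsub>subst_monoid v\<^esub>"
    using assms by (auto simp: prime_substs_def units_of_def Units_def)
  \<comment> \<open>Left general in \<open>S\<close> and \<open>T\<close>, since both orders of the
    product are needed.\<close>
  have inv: "taut (Iff (subst (\<lambda>i. rep (T i)) (rep (S i))) (Var i))"
    if "S \<otimes>\<^bsub>subst_monoid v\<^esub> T = \<one>\<^bsub>subst_monoid v\<^esub>" "i < v" for S T i
  proof -
    have "C_rel v `` {subst (\<lambda>j. rep (T j)) (rep (S i))} = C_rel v `` {Var i}"
      using fun_cong[OF that(1), of i] that(2) by (simp add: subst_monoid_def)
    then have "(subst (\<lambda>j. rep (T j)) (rep (S i)), Var i) \<in> C_rel v"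
      using C_cls_self[of "Var i" v] that(2) by auto
    then show ?thesis
      by (simp add: C_rel_def)
  qed
  have "inverse_substs v (\<lambda>i. rep (\<sigma> i)) (\<lambda>i. rep (\<tau> i))"
    using rep_subst_forms[OF \<sigma>] rep_subst_forms[OF \<tau>] inv[OF eq(1)] inv[OF eq(2)]
    by unfold_locales
  with \<sigma> \<tau> show ?thesis
    by (rule that)
qed

lemma K_act_rep:
  assumes "S \<in> carrier (subst_monoid v)" "\<phi> \<in> forms v d"
  shows "K_act v d S (K_cls v d \<phi>) = K_cls v d (subst (\<lambda>i. rep (S i)) \<phi>)"
  using assms by (intro K_act_cls) (auto simp: subst_monoid_def intro!: rep_in_C)

theorem theorem4:
  fixes v d :: nat and \<sigma> :: "nat \<Rightarrow> fm set"
  assumes "\<sigma> \<in> carrier (prime_substs v)"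
  shows "bij_betw (K_act v d \<sigma>) (minterms v d) (minterms v d) \<and>
         lattice_automorphism (K_alg v d) (K_act v d \<sigma>)"
proof -
  obtain \<tau> where \<sigma>: "\<sigma> \<in> carrier (subst_monoid v)" and \<tau>: "\<tau> \<in> carrier (subst_monoid v)"
    and inv: "inverse_substs v (\<lambda>i. rep (\<sigma> i)) (\<lambda>i. rep (\<tau> i))"
    using assms by (rule prime_subst_inverse)
  let ?C = "carrier (K_alg v d)"
  have inv': "inverse_substs v (\<lambda>i. rep (\<tau> i)) (\<lambda>i. rep (\<sigma> i))"
    using inv by (rule inverse_substs.inverse_substs_sym)
  have sub: "subst (\<lambda>i. rep (S i)) \<phi> \<in> forms v d"
    if "S \<in> carrier (subst_monoid v)" "\<phi> \<in> forms v d" for S \<phi>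
    using that rep_subst_forms by (intro subst_forms)
  have closed: "K_act v d S X \<in> ?C" if "S \<in> carrier (subst_monoid v)" "X \<in> ?C" for S X
    using that by (auto elim!: K_alg_carrierE simp: K_act_rep intro!: K_cls_carrier sub)
  have cancel: "K_act v d T (K_act v d S X) = X"
    if "S \<in> carrier (subst_monoid v)" "T \<in> carrier (subst_monoid v)" "X \<in> ?C"
      "inverse_substs v (\<lambda>i. rep (S i)) (\<lambda>i. rep (T i))" for S T X
    using that
    by (auto elim!: K_alg_carrierE simp: K_act_rep sub inverse_substs.K_cls_subst_subst)
  have minterm: "K_act v d S X \<in> minterms v d"
    if S: "S \<in> carrier (subst_monoid v)" and X: "X \<in> minterms v d"
      and ST: "inverse_substs v (\<lambda>i. rep (S i)) (\<lambda>i. rep (T i))" for S T X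
  proof -
    obtain \<mu> where \<mu>: "\<mu> \<in> set (minterm_list v d)" "X = K_cls v d \<mu>"
      using X by (auto simp: minterms_def)
    then show ?thesis
      using inverse_substs.subst_minterm[OF ST \<mu>(1)] minterm_list_forms[of v d] S
      by (simp add: K_act_rep subset_iff)
  qed
  have minterms_carrier: "minterms v d \<subseteq> ?C"
    using minterm_list_forms by (auto simp: minterms_def intro!: K_cls_carrier)
  \<comment> \<open>The action of \<open>\<tau>\<close> is a two-sided inverse that also preserves
    minterms, so it witnesses bijectivity here and on the whole algebra.\<close>
  have "bij_betw (K_act v d \<sigma>) (minterms v d) (minterms v d)"
    by (rule bij_betw_byWitness[where f' = "K_act v d \<tau>"])
       (use \<sigma> \<tau> inv inv' cancel minterm minterms_carrier in blast)+
  moreover have "bij_betw (K_act v d \<sigma>) ?C ?C"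
    by (rule bij_betw_byWitness[where f' = "K_act v d \<tau>"])
       (use \<sigma> \<tau> inv inv' cancel closed in blast)+
  \<comment> \<open>Joins are classes of disjunctions, and \<open>subst\<close> commutes with
    \<open>Or\<close> by definition.\<close>
  moreover have "join_pres (K_alg v d) (K_alg v d) (K_act v d \<sigma>)"
    using K_alg_lattice \<sigma>
    by (auto simp: join_pres_def K_alg_join K_act_rep sub elim!: K_alg_carrierE)
  moreover have "meet_pres (K_alg v d) (K_alg v d) (K_act v d \<sigma>)"
    using K_alg_lattice \<sigma>
    by (auto simp: meet_pres_def K_alg_meet K_act_rep sub elim!: K_alg_carrierE)
  ultimately show ?thesis
    by (simp add: lattice_automorphism_def)
qed

end
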